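(* Let $K$ be a field and let $G$ be an unmixed bipartite graph on the vertex set $\{x_1,\ldots,x_n\}\cup\{y_1,\ldots,y_n\}$ (with these two sets as bipartition classes and without isolated vertices). Then the toric ideal $I_G\subset S_G$ of $\mathcal{R}_G$ has a squarefree quadratic initial ideal with respect to a reverse lexicographic order; that is, there is a reverse lexicographic monomial order on $S_G$ for which the initial ideal of $I_G$ is generated by squarefree monomials of degree $2$.
   Context: All graphs are finite with no loops, no multiple edges and no isolated vertices. A vertex cover of $G$ is a subset $C$ of the vertex set such that every edge of $G$ has at least one endpoint in $C$; it is minimal if no proper subset of $C$ is a vertex cover. $G$ is unmixed if all its minimal vertex covers have the same cardinality. $\mathcal{M}(G)$ denotes the set of all minimal vertex covers of $G$. For an unmixed bipartite graph without isolated vertices the two bipartition classes are minimal vertex covers, hence have the same size $n$, and every minimal vertex cover has cardinality $n$. Let $K[x_1,\ldots,x_n,y_1,\ldots,y_n]$ be the polynomial ring in $2n$ variables over $K$ with $\deg x_i=\deg y_i=1$. To each $C\in\mathcal{M}(G)$ associate the squarefree monomial $u_C=\prod_{v\in C}v$ of degree $n$. Let $\mathcal{R}_G$ be the $K$-subalgebra (semigroup ring) of $K[x_1,\ldots,x_n,y_1,\ldots,y_n]$ generated by all $u_C$ with $C\in\mathcal{M}(G)$. Let $S_G=K[\{z_C\}_{C\in\mathcal{M}(G)}]$ be the polynomial ring in $|\mathcal{M}(G)|$ variables over $K$. The toric ideal $I_G$ of $\mathcal{R}_G$ is the kernel of the surjective $K$-algebra homomorphism $\pi:S_G\to\mathcal{R}_G$,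 $\pi(z_C)=u_C$. A reverse lexicographic order on $S_G$ means the (graded) reverse lexicographic monomial order induced by some total order of the variables $z_C$. The generating set of squarefree quadratic monomials may be empty (when $I_G=0$). *)

theory Defs
  imports "HOL-Algebra.Generated_Rings" "HOL-Library.Poly_Mapping"
begin

section \<open>Graphs and vertex covers\<close>

text \<open>
  A graph is given by its vertex set \<open>V\<close> and its set \<open>E\<close> of edges, where an edge is the
  two-element set of its endpoints.
\<close>

definition simple_graph :: "'v set \<Rightarrow> 'v set set \<Rightarrow> bool" where
  "simple_graph V E \<longleftrightarrow> finite V \<and> (\<forall>e\<in>E. e \<subseteq> V \<and> card e = 2)"

definition no_isolated_vertices :: "'v set \<Rightarrow> 'v set set \<Rightarrow> bool" where
  "no_isolated_vertices V E \<longleftrightarrow> (\<forall>v\<in>V. \<exists>e\<in>E. v \<in> e)"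

definition bipartition :: "'v set \<Rightarrow> 'v set set \<Rightarrow> 'v set \<Rightarrow> 'v set \<Rightarrow> bool" where
  "bipartition V E A B \<longleftrightarrow>
     V = A \<union> B \<and> A \<inter> B = {} \<and> (\<forall>e\<in>E. \<exists>a\<in>A. \<exists>b\<in>B. e = {a, b})"

definition vertex_cover :: "'v set \<Rightarrow> 'v set set \<Rightarrow> 'v set \<Rightarrow> bool" where
  "vertex_cover V E C \<longleftrightarrow> C \<subseteq> V \<and> (\<forall>e\<in>E. e \<inter> C \<noteq> {})"

definition minimal_vertex_covers :: "'v set \<Rightarrow> 'v set set \<Rightarrow> 'v set set" where
  "minimal_vertex_covers V E =
     {C. vertex_cover V E C \<and> (\<forall>D. D \<subset> C \<longrightarrow> \<not> vertex_cover V E D)}"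

definition unmixed :: "'v set \<Rightarrow> 'v set set \<Rightarrow> bool" where
  "unmixed V E \<longleftrightarrow>
     (\<forall>C\<in>minimal_vertex_covers V E. \<forall>D\<in>minimal_vertex_covers V E. card C = card D)"

datatype vertex = Vx nat | Vy nat

definition x_vertices :: "nat \<Rightarrow> vertex set" where
  "x_vertices n = Vx ` {1..n}"

definition y_vertices :: "nat \<Rightarrow> vertex set" where
  "y_vertices n = Vy ` {1..n}"


section \<open>Polynomial rings\<close>

text \<open>
  A monomial is its exponent vector, a finitely supported function from the variables to the
  natural numbers, and a polynomial is a finitely supported function from monomials to
  coefficients. For a set \<open>A\<close> of variables, the ring \<open>K[A]\<close> consists of those polynomials in
  which only variables from \<open>A\<close> occur.
\<close>

type_synonym 'v monomial = "'v \<Rightarrow>\<^sub>0 nat"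
type_synonym ('v, 'k) mpoly = "'v monomial \<Rightarrow>\<^sub>0 'k"

definition mpoly_ring :: "'v set \<Rightarrow> ('v, 'k :: comm_ring_1) mpoly ring" where
  "mpoly_ring A =
     \<lparr>carrier = {p. \<forall>m\<in>Poly_Mapping.keys p. Poly_Mapping.keys m \<subseteq> A},
      mult = (*), one = 1, zero = 0, add = (+)\<rparr>"

definition mpoly_const :: "'k :: comm_ring_1 \<Rightarrow> ('v, 'k) mpoly" where
  "mpoly_const c = Poly_Mapping.single 0 c"

definition monom_poly :: "'v monomial \<Rightarrow> ('v, 'k :: comm_ring_1) mpoly" where
  "monom_poly m = Poly_Mapping.single m 1"

definition mpoly_var :: "'v \<Rightarrow> ('v, 'k :: comm_ring_1) mpoly" where
  "mpoly_var v = monom_poly (Poly_Mapping.single v 1)"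

definition mdegree :: "'v monomial \<Rightarrow> nat" where
  "mdegree m = (\<Sum>v\<in>Poly_Mapping.keys m. Poly_Mapping.lookup m v)"

definition squarefree_monomial :: "'v monomial \<Rightarrow> bool" where
  "squarefree_monomial m \<longleftrightarrow> (\<forall>v. Poly_Mapping.lookup m v \<le> 1)"

text \<open>The \<open>K\<close>-algebra homomorphism that sends each variable \<open>v\<close> to \<open>f v\<close>.\<close>

definition mpoly_subst ::
    "('v \<Rightarrow> ('w, 'k) mpoly) \<Rightarrow> ('v, 'k :: comm_ring_1) mpoly \<Rightarrow> ('w, 'k) mpoly" where
  "mpoly_subst f p =
     (\<Sum>m\<in>Poly_Mapping.keys p.
        mpoly_const (Poly_Mapping.lookup p m) *
        (\<Prod>v\<in>Poly_Mapping.keys m. f v ^ Poly_Mapping.lookup m v))"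

text \<open>
  Ideals below are ideals of the ring \<open>mpoly_ring A\<close> in the sense of the algebra library;
  \<open>Idl\<close> is an intersection of ideals, so it is meaningful because of this lemma.
\<close>

lemma cring_mpoly_ring: "cring (mpoly_ring A :: ('v, 'k :: comm_ring_1) mpoly ring)"
proof (rule cringI)
  show "abelian_group (mpoly_ring A :: ('v, 'k) mpoly ring)"
  proof (rule abelian_groupI)
    fix p q :: "('v, 'k) mpoly"
    assume "p \<in> carrier (mpoly_ring A)" "q \<in> carrier (mpoly_ring A)"
    then show "p \<oplus>\<^bsub>mpoly_ring A\<^esub> q \<in> carrier (mpoly_ring A)"
      using keys_add[of p q] by (fastforce simp: mpoly_ring_def)
  next
    fix p :: "('v, 'k) mpoly"
    assume "p \<in> carrier (mpoly_ring A)"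
    then show "\<exists>q\<in>carrier (mpoly_ring A). q \<oplus>\<^bsub>mpoly_ring A\<^esub> p = \<zero>\<^bsub>mpoly_ring A\<^esub>"
      by (intro bexI[of _ "- p"]) (auto simp: mpoly_ring_def)
  qed (auto simp: mpoly_ring_def ac_simps)
  show "Group.comm_monoid (mpoly_ring A :: ('v, 'k) mpoly ring)"
  proof (rule comm_monoidI)
    fix p q :: "('v, 'k) mpoly"
    assume pq: "p \<in> carrier (mpoly_ring A)" "q \<in> carrier (mpoly_ring A)"
    have "Poly_Mapping.keys m \<subseteq> A" if "m \<in> Poly_Mapping.keys (p * q)" for m
    proof -
      obtain a b where ab: "m = a + b" "a \<in> Poly_Mapping.keys p" "b \<in> Poly_Mapping.keys q"
        using keys_mult[of p q] \<open>m \<in> Poly_Mapping.keys (p * q)\<close> by blast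
      then have "Poly_Mapping.keys a \<subseteq> A" "Poly_Mapping.keys b \<subseteq> A"
        using pq by (auto simp: mpoly_ring_def)
      then show ?thesis
        using keys_add[of a b] ab by blast
    qed
    then show "p \<otimes>\<^bsub>mpoly_ring A\<^esub> q \<in> carrier (mpoly_ring A)"
      by (simp add: mpoly_ring_def)
  qed (auto simp: mpoly_ring_def ac_simps)
qed (auto simp: mpoly_ring_def algebra_simps)


section \<open>Reverse lexicographic order and initial ideals\<close>

text \<open>
  Here \<open>r\<close> is a total order of the variables, \<open>(w, v) \<in> r\<close> meaning that \<open>w\<close> is at most \<open>v\<close>.
  Among monomials of the same degree, \<open>a\<close> is smaller than \<open>b\<close> iff the smallest variable whose
  exponents in \<open>a\<close> and \<open>b\<close> differ has the larger exponent in \<open>a\<close>.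
\<close>

definition grevlex :: "'v rel \<Rightarrow> 'v monomial \<Rightarrow> 'v monomial \<Rightarrow> bool" where
  "grevlex r a b \<longleftrightarrow>
     mdegree a < mdegree b \<or>
     mdegree a = mdegree b \<and>
       (\<exists>v. Poly_Mapping.lookup b v < Poly_Mapping.lookup a v \<and>
         (\<forall>w. (w, v) \<in> r \<and> w \<noteq> v \<longrightarrow>
              Poly_Mapping.lookup a w = Poly_Mapping.lookup b w))"

definition initial_monomial ::
    "('v monomial \<Rightarrow> 'v monomial \<Rightarrow> bool) \<Rightarrow> ('v, 'k :: comm_ring_1) mpoly \<Rightarrow> 'v monomial" where
  "initial_monomial lt p =
     (THE m. m \<in> Poly_Mapping.keys p \<and> (\<forall>m'\<in>Poly_Mapping.keys p. m' \<noteq> m \<longrightarrow> lt m' m))"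

text \<open>The definite description in \<open>initial_monomial\<close> denotes, by \<open>initial_monomial_unique\<close> below.\<close>

lemma grevlex_total:
  assumes r: "linear_order_on A r" and fin: "finite A"
    and "a \<noteq> b"
  shows "grevlex r a b \<or> grevlex r b a"
proof -
  define D where "D = {v. Poly_Mapping.lookup a v \<noteq> Poly_Mapping.lookup b v}"
  have "D \<noteq> {}"
    using \<open>a \<noteq> b\<close> poly_mapping_eqI[of a b] unfolding D_def by blast
  moreover have "wf (r - Id)"
  proof (rule finite_acyclic_wf)
    have "r \<subseteq> A \<times> A"
      using r by (simp add: order_on_defs)
    then show "finite (r - Id)"
      using fin by (meson finite_Diff finite_SigmaI finite_subset)
    have "trans (r - Id)"
      using r by (simp add: order_on_defs trans_diff_Id)
    then show "acyclic (r - Id)"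
      by (simp add: acyclic_def trancl_id)
  qed
  ultimately obtain v where v: "v \<in> D" "\<And>w. (w, v) \<in> r - Id \<Longrightarrow> w \<notin> D"
    using wfE_min[of "r - Id" _ D] by blast
  then have "\<forall>w. (w, v) \<in> r \<and> w \<noteq> v \<longrightarrow> Poly_Mapping.lookup a w = Poly_Mapping.lookup b w"
    by (auto simp: D_def)
  moreover from v(1) have "Poly_Mapping.lookup a v < Poly_Mapping.lookup b v \<or>
      Poly_Mapping.lookup b v < Poly_Mapping.lookup a v"
    by (auto simp: D_def)
  moreover have "mdegree a < mdegree b \<or> mdegree b < mdegree a \<or> mdegree a = mdegree b"
    by linarith
  ultimately show ?thesis
    unfolding grevlex_def by (metis (no_types, lifting))
qed

lemma grevlex_trans:
  assumes r: "linear_order_on A r"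
    and a: "Poly_Mapping.keys a \<subseteq> A" and b: "Poly_Mapping.keys b \<subseteq> A"
    and ab: "grevlex r a b" and bc: "grevlex r b c"
  shows "grevlex r a c"
proof (cases "mdegree a = mdegree b \<and> mdegree b = mdegree c")
  case False
  with ab bc show ?thesis by (auto simp: grevlex_def)
next
  case True
  with ab obtain v where v: "Poly_Mapping.lookup b v < Poly_Mapping.lookup a v"
      "\<And>w. (w, v) \<in> r \<Longrightarrow> w \<noteq> v \<Longrightarrow> Poly_Mapping.lookup a w = Poly_Mapping.lookup b w"
    by (auto simp: grevlex_def)
  from True bc obtain u where u: "Poly_Mapping.lookup c u < Poly_Mapping.lookup b u"
      "\<And>w. (w, u) \<in> r \<Longrightarrow> w \<noteq> u \<Longrightarrow> Poly_Mapping.lookup b w = Poly_Mapping.lookup c w"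
    by (auto simp: grevlex_def)
  have "v \<in> A" "u \<in> A"
    using v(1) u(1) a b by (auto simp: in_keys_iff subset_iff)
  then consider "u = v" | "u \<noteq> v" "(u, v) \<in> r" | "u \<noteq> v" "(v, u) \<in> r"
    using r by (auto simp: linear_order_on_def total_on_def)
  moreover have trans: "trans r" and anti: "antisym r"
    using r by (auto simp: order_on_defs)
  ultimately have "\<exists>v. Poly_Mapping.lookup c v < Poly_Mapping.lookup a v \<and>
      (\<forall>w. (w, v) \<in> r \<and> w \<noteq> v \<longrightarrow> Poly_Mapping.lookup a w = Poly_Mapping.lookup c w)"
  proof cases
    case 1
    then show ?thesis using u v by (intro exI[of _ v]) auto
  next
    case 2
    have "Poly_Mapping.lookup a w = Poly_Mapping.lookup c w" if "(w, u) \<in> r" "w \<noteq> u" for w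
      using that 2 u(2)[of w] v(2)[of w] transD[OF trans, of w u v] antisymD[OF anti, of u v] by auto
    then show ?thesis using 2 u v by (intro exI[of _ u]) auto
  next
    case 3
    have "Poly_Mapping.lookup a w = Poly_Mapping.lookup c w" if "(w, v) \<in> r" "w \<noteq> v" for w
      using that 3 u(2)[of w] v(2)[of w] transD[OF trans, of w v u] antisymD[OF anti, of u v] by auto
    then show ?thesis using 3 u(2)[of v] v by (intro exI[of _ v]) auto
  qed
  with True show ?thesis by (auto simp: grevlex_def)
qed

lemma initial_monomial_unique:
  assumes r: "linear_order_on A r" and "finite A"
    and "p \<in> carrier (mpoly_ring A)" and "p \<noteq> 0"
  shows "\<exists>!m. m \<in> Poly_Mapping.keys p \<and>
            (\<forall>m'\<in>Poly_Mapping.keys p. m' \<noteq> m \<longrightarrow> grevlex r m' m)"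
proof -
  have irr: "\<not> grevlex r a a" for a by (simp add: grevlex_def)
  have ex: "\<exists>m\<in>M. \<forall>m'\<in>M. m' \<noteq> m \<longrightarrow> grevlex r m' m"
    if "finite M" "M \<noteq> {}" "\<forall>m\<in>M. Poly_Mapping.keys m \<subseteq> A" for M
    using that
  proof (induction M rule: finite_ne_induct)
    case (insert x F)
    then obtain m where m: "m \<in> F" "\<And>m'. m' \<in> F \<Longrightarrow> m' \<noteq> m \<Longrightarrow> grevlex r m' m"
      by auto
    have "grevlex r x m \<or> grevlex r m x"
      using insert m(1) by (intro grevlex_total[OF r \<open>finite A\<close>]) auto
    then show ?case
    proof
      assume "grevlex r x m"
      then show ?thesis using m by auto
    next
      assume mx: "grevlex r m x"
      have "grevlex r m' x" if "m' \<in> F" for m'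
        using m(2)[OF that] mx grevlex_trans[OF r, of m' m x] insert.prems that m(1)
        by (cases "m' = m") auto
      then show ?thesis by auto
    qed
  qed auto
  have sub: "\<forall>m\<in>Poly_Mapping.keys p. Poly_Mapping.keys m \<subseteq> A"
    using assms(3) by (simp add: mpoly_ring_def)
  moreover have "Poly_Mapping.keys p \<noteq> {}" using \<open>p \<noteq> 0\<close> by simp
  ultimately obtain m where m: "m \<in> Poly_Mapping.keys p"
      "\<And>m'. m' \<in> Poly_Mapping.keys p \<Longrightarrow> m' \<noteq> m \<Longrightarrow> grevlex r m' m"
    using ex[of "Poly_Mapping.keys p"] by auto
  show ?thesis
  proof (rule ex1I[of _ m])
    fix m1
    assume m1: "m1 \<in> Poly_Mapping.keys p \<and>
      (\<forall>m'\<in>Poly_Mapping.keys p. m' \<noteq> m1 \<longrightarrow> grevlex r m' m1)"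
    show "m1 = m"
    proof (rule ccontr)
      assume "m1 \<noteq> m"
      then have "grevlex r m1 m" "grevlex r m m1"
        using m m1 by auto
      then show False
        using irr[of m] grevlex_trans[OF r, of m m1 m] sub m(1) m1 by auto
    qed
  qed (use m in blast)
qed

definition initial_ideal ::
    "'v set \<Rightarrow> ('v monomial \<Rightarrow> 'v monomial \<Rightarrow> bool) \<Rightarrow>
     ('v, 'k :: comm_ring_1) mpoly set \<Rightarrow> ('v, 'k) mpoly set" where
  "initial_ideal A lt I =
     Idl\<^bsub>mpoly_ring A\<^esub> {monom_poly (initial_monomial lt p) | p. p \<in> I \<and> p \<noteq> 0}"


section \<open>The vertex cover algebra and its toric ideal\<close>

definition cover_monomial :: "'v set \<Rightarrow> ('v, 'k :: comm_ring_1) mpoly" where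
  "cover_monomial C = (\<Prod>v\<in>C. mpoly_var v)"

text \<open>The \<open>K\<close>-subalgebra \<open>R\<^sub>G\<close> of \<open>K[V]\<close>: the subring generated by \<open>K\<close> and all \<open>u\<^sub>C\<close>.\<close>

definition cover_algebra :: "'v set \<Rightarrow> 'v set set \<Rightarrow> ('v, 'k :: comm_ring_1) mpoly ring" where
  "cover_algebra V E =
     (mpoly_ring V)\<lparr>carrier :=
        generate_ring (mpoly_ring V)
          (range mpoly_const \<union> cover_monomial ` minimal_vertex_covers V E)\<rparr>"

text \<open>
  The ring \<open>S\<^sub>G\<close> has the minimal vertex covers themselves as its variables, that is, \<open>z\<^sub>C\<close>
  is \<open>mpoly_var C\<close>.
\<close>

definition cover_poly_ring ::
    "'v set \<Rightarrow> 'v set set \<Rightarrow> ('v set, 'k :: comm_ring_1) mpoly ring" where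
  "cover_poly_ring V E = mpoly_ring (minimal_vertex_covers V E)"

definition toric_ideal ::
    "'v set \<Rightarrow> 'v set set \<Rightarrow> ('v set, 'k :: comm_ring_1) mpoly set" where
  "toric_ideal V E =
     a_kernel (cover_poly_ring V E) (cover_algebra V E) (mpoly_subst cover_monomial)"

end

theory Submission
  imports Defs
begin

text \<open>
  In an unmixed bipartite graph the minimal vertex covers form a lattice: the meet of \<open>C\<close> and \<open>D\<close>
  intersects their \<open>X\<close>-parts and unites their \<open>Y\<close>-parts, and the join does the opposite. Both are
  vertex covers, and their sizes add up to \<open>card C + card D\<close>, so both have the least possible size.
  Since \<open>u\<^sub>C u\<^sub>D = u\<^bsub>C \<and> D\<^esub> u\<^bsub>C \<or> D\<^esub>\<close>, every incomparable pair gives a binomial in \<open>I\<^sub>G\<close>, whose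
  initial monomial is \<open>z\<^sub>C z\<^sub>D\<close> as soon as the variables are ordered by a linear extension of the
  lattice order. Conversely, a monomial supported on a chain is the smallest one among all
  monomials with the same image under \<open>\<pi>\<close>, so it is not the initial monomial of an element of
  \<open>I\<^sub>G\<close>: after cancelling common factors, the least cover of the chain consists of the \<open>x\<close>
  occurring in all factors of the image and the \<open>y\<close> occurring in some factor, so it lies below
  all covers in any other factorization.
\<close>

section \<open>The lattice of minimal vertex covers\<close>

text \<open>The inclusion is reversed on \<open>Y\<close>. For this order
  \<open>cover_meet X Y\<close> is the infimum and \<open>cover_meet Y X\<close> the supremum on
  subsets of \<open>X \<union> Y\<close>.\<close>

definition cover_le :: "'v set \<Rightarrow> 'v set \<Rightarrow> 'v set \<Rightarrow> 'v set \<Rightarrow> bool" where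
  "cover_le X Y C D \<longleftrightarrow> C \<inter> X \<subseteq> D \<and> D \<inter> Y \<subseteq> C"

text \<open>The join is the meet with the roles of \<open>X\<close> and \<open>Y\<close> exchanged.\<close>

definition cover_meet :: "'v set \<Rightarrow> 'v set \<Rightarrow> 'v set \<Rightarrow> 'v set \<Rightarrow> 'v set" where
  "cover_meet X Y C D = (C \<inter> D \<inter> X) \<union> ((C \<union> D) \<inter> Y)"

text \<open>What the algebraic part needs from the graph: closure under both operations and a common
  size \<open>c\<close>. Since \<open>c\<close> is positive, the degree of a monomial can be read
  off from its image.\<close>

locale cover_lattice =
  fixes X Y :: "'v set" and M :: "'v set set" and c :: nat
  assumes finite_X: "finite X" and finite_Y: "finite Y" and disjoint: "X \<inter> Y = {}"
    and M_sub: "C \<in> M \<Longrightarrow> C \<subseteq> X \<union> Y"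
    and card_M: "C \<in> M \<Longrightarrow> card C = c"
    and c_pos: "c > 0"
    and meet_M: "C \<in> M \<Longrightarrow> D \<in> M \<Longrightarrow> cover_meet X Y C D \<in> M"
    and join_M: "C \<in> M \<Longrightarrow> D \<in> M \<Longrightarrow> cover_meet Y X C D \<in> M"

text \<open>If the meet misses the \<open>X\<close>-end of an edge, then so does \<open>C\<close> or
  \<open>D\<close>. That cover contains the \<open>Y\<close>-end, and the meet inherits it.\<close>

lemma vertex_cover_meet:
  assumes "bipartition V E X Y" "vertex_cover V E C" "vertex_cover V E D"
  shows "vertex_cover V E (cover_meet X Y C D)"
  unfolding vertex_cover_def
proof (intro conjI ballI)
  show "cover_meet X Y C D \<subseteq> V"
    using assms by (auto simp: vertex_cover_def cover_meet_def)
next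
  fix e assume e: "e \<in> E"
  then obtain a b where ab: "a \<in> X" "b \<in> Y" "e = {a, b}"
    using assms(1) by (auto simp: bipartition_def)
  have "e \<inter> C \<noteq> {}" "e \<inter> D \<noteq> {}" using e assms by (auto simp: vertex_cover_def)
  then show "e \<inter> cover_meet X Y C D \<noteq> {}"
    using ab by (auto simp: cover_meet_def)
qed

text \<open>Lets \<open>vertex_cover_meet\<close> serve for joins as well.\<close>

lemma bipartition_swap: "bipartition V E X Y \<Longrightarrow> bipartition V E Y X"
  unfolding bipartition_def by (simp add: Un_commute Int_commute) (metis insert_commute)

text \<open>On each side of the bipartition one of the two sets is the intersection and the other
  the union, so inclusion-exclusion applies to each side.\<close>

lemma card_cover_meet_join:
  assumes "finite X" "finite Y" "X \<inter> Y = {}" "C \<subseteq> X \<union> Y" "D \<subseteq> X \<union> Y"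
  shows "card (cover_meet X Y C D) + card (cover_meet Y X C D) = card C + card D"
proof -
  have fin: "finite C" "finite D" using assms finite_subset by blast+
  have split: "card S = card (S \<inter> X) + card (S \<inter> Y)" if "S \<subseteq> X \<union> Y" for S
  proof -
    have "S = (S \<inter> X) \<union> (S \<inter> Y)" using that by auto
    then show ?thesis
      using card_Un_disjoint[of "S \<inter> X" "S \<inter> Y"] assms by auto
  qed
  have meet: "cover_meet X Y C D \<inter> X = (C \<inter> X) \<inter> (D \<inter> X)"
    "cover_meet X Y C D \<inter> Y = (C \<inter> Y) \<union> (D \<inter> Y)"
    "cover_meet Y X C D \<inter> X = (C \<inter> X) \<union> (D \<inter> X)"
    "cover_meet Y X C D \<inter> Y = (C \<inter> Y) \<inter> (D \<inter> Y)"
    using assms(3) by (auto simp: cover_meet_def)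
  have sub: "cover_meet X Y C D \<subseteq> X \<union> Y" "cover_meet Y X C D \<subseteq> X \<union> Y"
    by (auto simp: cover_meet_def)
  show ?thesis
    using split[OF sub(1)] split[OF sub(2)] split[OF assms(4)] split[OF assms(5)]
      card_Un_Int[of "C \<inter> X" "D \<inter> X"] card_Un_Int[of "C \<inter> Y" "D \<inter> Y"] fin
    unfolding meet by simp
qed

lemma vertex_cover_contains_minimal:
  assumes "finite C" "vertex_cover V E C"
  shows "\<exists>D\<in>minimal_vertex_covers V E. D \<subseteq> C"
  using assms
proof (induction C rule: finite_psubset_induct)
  case (psubset C)
  show ?case
  proof (cases "C \<in> minimal_vertex_covers V E")
    case False
    then obtain D where D: "D \<subset> C" "vertex_cover V E D"
      using psubset.prems by (auto simp: minimal_vertex_covers_def)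
    from psubset.IH[OF this] D(1) show ?thesis by auto
  qed auto
qed

text \<open>Every cover contains a minimal one, so unmixedness makes the minimal covers exactly the
  covers of least size. An edge rules out the empty cover, which gives \<open>c > 0\<close>.\<close>

lemma cover_lattice_minimal_vertex_covers:
  assumes graph: "simple_graph V E" and bip: "bipartition V E X Y" and um: "unmixed V E"
    and "E \<noteq> {}"
  shows "\<exists>c. cover_lattice X Y (minimal_vertex_covers V E) c"
proof -
  have V: "V = X \<union> Y" "X \<inter> Y = {}" using bip by (auto simp: bipartition_def)
  have fin: "finite V" "finite X" "finite Y"
    using graph V(1) by (auto simp: simple_graph_def)
  have finC: "finite C" if "vertex_cover V E C" for C
    using that fin(1) finite_subset by (auto simp: vertex_cover_def)
  have "vertex_cover V E V"
    unfolding vertex_cover_def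
  proof (intro conjI ballI)
    fix e assume "e \<in> E"
    then have "e \<subseteq> V" "e \<noteq> {}" using graph by (auto simp: simple_graph_def)
    then show "e \<inter> V \<noteq> {}" by auto
  qed simp
  then obtain C0 where C0: "C0 \<in> minimal_vertex_covers V E"
    using vertex_cover_contains_minimal[OF fin(1)] by blast
  have eq: "card C = card C0" if "C \<in> minimal_vertex_covers V E" for C
    using um that C0 unfolding unmixed_def by blast
  have le: "card C0 \<le> card C" if C: "vertex_cover V E C" for C
  proof -
    obtain D where D: "D \<in> minimal_vertex_covers V E" "D \<subseteq> C"
      using vertex_cover_contains_minimal[OF finC[OF C] C] by blast
    then show ?thesis using eq[OF D(1)] card_mono[OF finC[OF C] D(2)] by simp
  qed
  have minI: "C \<in> minimal_vertex_covers V E" if C: "vertex_cover V E C" "card C \<le> card C0" for C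
  proof -
    have "\<not> vertex_cover V E D" if "D \<subset> C" for D
      using le[of D] psubset_card_mono[OF finC[OF C(1)] that] C(2) by auto
    then show ?thesis using C(1) by (simp add: minimal_vertex_covers_def)
  qed
  have mem: "vertex_cover V E C" if "C \<in> minimal_vertex_covers V E" for C
    using that by (simp add: minimal_vertex_covers_def)
  have "C0 \<noteq> {}"
    using mem[OF C0] \<open>E \<noteq> {}\<close> by (auto simp: vertex_cover_def)
  then have pos: "card C0 > 0" using finC mem C0 by (simp add: card_gt_0_iff)
  have both: "cover_meet X Y C D \<in> minimal_vertex_covers V E \<and>
      cover_meet Y X C D \<in> minimal_vertex_covers V E"
    if CD: "C \<in> minimal_vertex_covers V E" "D \<in> minimal_vertex_covers V E" for C D
  proof -
    have v: "vertex_cover V E (cover_meet X Y C D)" "vertex_cover V E (cover_meet Y X C D)"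
      using vertex_cover_meet[OF bip] vertex_cover_meet[OF bipartition_swap[OF bip]] mem CD by auto
    have "C \<subseteq> X \<union> Y" "D \<subseteq> X \<union> Y" using mem CD V by (auto simp: vertex_cover_def)
    then have "card (cover_meet X Y C D) + card (cover_meet Y X C D) = card C0 + card C0"
      using card_cover_meet_join[OF fin(2,3) V(2)] eq[OF CD(1)] eq[OF CD(2)] by simp
    then show ?thesis using le[OF v(1)] le[OF v(2)] minI v by auto
  qed
  have "cover_lattice X Y (minimal_vertex_covers V E) (card C0)"
    using fin V pos eq both mem by unfold_locales (auto simp: vertex_cover_def)
  then show ?thesis ..
qed

section \<open>Linear extensions and chains in the lattice of covers\<close>

context cover_lattice
begin

lemma finite_M: "finite M"
  using M_sub finite_X finite_Y by (auto intro!: finite_subset[of M "Pow (X \<union> Y)"])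

lemma finite_mem: "C \<in> M \<Longrightarrow> finite C"
  using M_sub finite_X finite_Y finite_subset by blast

text \<open>Equal \<open>X\<close>-parts would force \<open>D \<subseteq> C\<close>, hence
  \<open>D = C\<close> by equal size. So the size of the \<open>X\<close>-part is a strictly
  monotone rank.\<close>

lemma card_less:
  assumes "C \<in> M" "D \<in> M" "cover_le X Y C D" "C \<noteq> D"
  shows "card (C \<inter> X) < card (D \<inter> X)"
proof (rule ccontr)
  assume "\<not> ?thesis"
  moreover have sub: "C \<inter> X \<subseteq> D \<inter> X" "D \<inter> Y \<subseteq> C \<inter> Y"
    using assms(3) by (auto simp: cover_le_def)
  ultimately have "C \<inter> X = D \<inter> X"
    using finite_X by (intro card_seteq) auto
  then have "D \<subseteq> C" using sub M_sub assms(2) by blast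
  then have "D = C"
    using card_M assms finite_mem by (metis card_subset_eq)
  then show False using assms(4) by simp
qed

text \<open>Sort by the size of the \<open>X\<close>-part and break ties by an arbitrary injection
  into the naturals.\<close>

lemma linear_extension:
  obtains r where "linear_order_on M r"
    "\<And>C D. C \<in> M \<Longrightarrow> D \<in> M \<Longrightarrow> cover_le X Y C D \<Longrightarrow> (C, D) \<in> r"
proof -
  obtain e :: "'v set \<Rightarrow> nat" where e: "inj_on e M"
    using finite_imp_inj_to_nat_seg[OF finite_M] by blast
  define r where "r = {(C, D). C \<in> M \<and> D \<in> M \<and>
    (card (C \<inter> X) < card (D \<inter> X) \<or> card (C \<inter> X) = card (D \<inter> X) \<and> e C \<le> e D)}"
  have "linear_order_on M r"
    unfolding order_on_defs
  proof (intro conjI)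
    show "r \<subseteq> M \<times> M" "refl_on M r" "trans r" "total_on M r"
      by (auto simp: r_def refl_on_def trans_def total_on_def)
    show "antisym r"
      using e by (auto simp: r_def antisym_def inj_on_def)
  qed
  moreover have "(C, D) \<in> r" if "C \<in> M" "D \<in> M" "cover_le X Y C D" for C D
    using that card_less by (cases "C = D") (auto simp: r_def)
  ultimately show ?thesis using that by blast
qed

text \<open>The combinatorial core: \<open>f\<close> and \<open>g\<close> are exponent vectors of monomials with the same image.\<close>

lemma chain_minimal_in_fibre:
  fixes f g :: "'v set \<Rightarrow> nat"
  assumes r: "linear_order_on M r"
    "\<And>C D. C \<in> M \<Longrightarrow> D \<in> M \<Longrightarrow> cover_le X Y C D \<Longrightarrow> (C, D) \<in> r"
    and chain: "\<And>C D. C \<in> M \<Longrightarrow> D \<in> M \<Longrightarrow> f C > 0 \<Longrightarrow> f D > 0 \<Longrightarrow>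
      cover_le X Y C D \<or> cover_le X Y D C"
    and sum_eq: "sum f M = sum g M"
    and fibre: "\<And>s. sum f {C \<in> M. s \<in> C} = sum g {C \<in> M. s \<in> C}"
    and v: "v \<in> M" "f v < g v" and below: "\<And>w. (w, v) \<in> r \<Longrightarrow> w \<noteq> v \<Longrightarrow> f w = g w"
  shows False
proof -
  \<comment> \<open>Truncated subtraction cancels the common factor: at each cover at most one of
    \<open>f'\<close> and \<open>g'\<close> is positive.\<close>
  define f' g' where "f' = (\<lambda>D. f D - g D)" and "g' = (\<lambda>D. g D - f D)"
  have cancel: "sum f' S = sum g' S" if "sum f S = sum g S" for S
  proof -
    \<comment> \<open>Both summands equal the pointwise maximum of \<open>f\<close> and
      \<open>g\<close>.\<close>
    have "sum f' S + sum g S = sum g' S + sum f S"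
      unfolding sum.distrib[symmetric] by (rule sum.cong) (auto simp: f'_def g'_def)
    then show ?thesis using that by simp
  qed
  have all: "sum f' M = sum g' M" using cancel sum_eq .
  have at: "sum f' {C \<in> M. s \<in> C} = sum g' {C \<in> M. s \<in> C}" for s using cancel fibre .
  have "g' v \<le> sum g' M" using v(1) finite_M by (intro member_le_sum) auto
  then have "sum g' M > 0" using v(2) by (simp add: g'_def)
  then have "sum f' M \<noteq> 0" using all by simp
  then have "\<exists>D\<in>M. f' D \<noteq> 0" by (meson sum.neutral)
  then obtain D where D: "D \<in> M" "f' D > 0" by auto
  define S where "S = {D \<in> M. f' D > 0}"
  have S: "finite S" "S \<noteq> {}" using D finite_M by (auto simp: S_def)
  \<comment> \<open>The support of \<open>f'\<close> is a chain, so a member with the smallest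
    \<open>X\<close>-part is its least element.\<close>
  then have "(MIN D\<in>S. card (D \<inter> X)) \<in> (\<lambda>D. card (D \<inter> X)) ` S" by (intro Min_in) auto
  then obtain C where C: "C \<in> S" "card (C \<inter> X) = (MIN D\<in>S. card (D \<inter> X))" by auto
  have least: "cover_le X Y C D" if "D \<in> S" for D
  proof -
    have "card (C \<inter> X) \<le> card (D \<inter> X)" using C(2) that S by simp
    moreover have "cover_le X Y C D \<or> cover_le X Y D C"
      using chain C(1) that by (auto simp: S_def f'_def)
    ultimately show ?thesis
      using card_less[of D C] C(1) that by (cases "C = D") (auto simp: S_def)
  qed
  have "cover_le X Y C v"
    unfolding cover_le_def
  proof (intro conjI subsetI)
    fix x assume x: "x \<in> C \<inter> X"
    \<comment> \<open>Every cover in \<open>S\<close> lies above \<open>C\<close> and so contains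
      \<open>x\<close>. Hence \<open>x\<close> has the full exponent in the image and must lie in
      every cover supporting \<open>g'\<close>, in particular in \<open>v\<close>.\<close>
    have "sum f' M = sum f' {D \<in> M. x \<in> D}"
      using least x finite_M
      by (intro sum.mono_neutral_right) (auto simp: cover_le_def S_def)
    then have eq: "sum g' {D \<in> M. x \<in> D} = sum g' M" using all at by simp
    show "x \<in> v"
    proof (rule ccontr)
      assume "x \<notin> v"
      then have "sum g' {D \<in> M. x \<in> D} < sum g' M"
        using v finite_M by (intro sum_strict_mono2[of M _ v]) (auto simp: g'_def)
      then show False using eq by simp
    qed
  next
    fix y assume y: "y \<in> v \<inter> Y"
    \<comment> \<open>As \<open>y\<close> divides the image, some cover in \<open>S\<close> contains
      it, and \<open>C\<close> has the largest \<open>Y\<close>-part in \<open>S\<close>.\<close>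
    have "g' v \<le> sum g' {D \<in> M. y \<in> D}"
      using v(1) y finite_M by (intro member_le_sum) auto
    then have "sum g' {D \<in> M. y \<in> D} \<noteq> 0" using v(2) by (simp add: g'_def)
    then have "sum f' {D \<in> M. y \<in> D} \<noteq> 0" using at by simp
    then have "\<exists>D\<in>{D \<in> M. y \<in> D}. f' D \<noteq> 0" by (meson sum.neutral)
    then obtain D where "D \<in> S" "y \<in> D" by (auto simp: S_def)
    then show "y \<in> C" using least y by (auto simp: cover_le_def)
  qed
  moreover have "f' C > 0" "C \<in> M" using C(1) by (auto simp: S_def)
  moreover have "f' v = 0" using v by (simp add: f'_def)
  \<comment> \<open>\<open>C\<close> differs from \<open>v\<close> because \<open>f' v = 0\<close>,
    so it strictly precedes \<open>v\<close> in \<open>r\<close>. There \<open>f\<close> and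
    \<open>g\<close> agree, against \<open>f' C > 0\<close>.\<close>
  ultimately show False
    using below[of C] r(2)[of C v] v(1) by (cases "C = v") (auto simp: f'_def)
qed

end


section \<open>Monomials and the toric map\<close>

lemma mdegree_eq_sum:
  assumes "finite A" "Poly_Mapping.keys m \<subseteq> A"
  shows "mdegree m = (\<Sum>v\<in>A. Poly_Mapping.lookup m v)"
  unfolding mdegree_def using assms by (intro sum.mono_neutral_left) (auto simp: in_keys_iff)

lemma mdegree_add: "mdegree (a + b) = mdegree a + mdegree b"
proof -
  let ?A = "Poly_Mapping.keys a \<union> Poly_Mapping.keys b"
  have "finite ?A" "Poly_Mapping.keys (a + b) \<subseteq> ?A" by (auto simp: keys_add)
  then show ?thesis
    by (simp add: mdegree_eq_sum[of ?A] lookup_add sum.distrib)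
qed

lemma mdegree_single [simp]: "mdegree (Poly_Mapping.single v k) = k"
  by (simp add: mdegree_def)

lemma monom_poly_mult: "monom_poly (a + b) = monom_poly a * monom_poly b"
  by (simp add: monom_poly_def mult_single)

text \<open>The exponent vector of \<open>\<pi>(m)\<close>: on monomials the toric map is a map of
  exponent vectors.\<close>

definition cover_exponent :: "'v set monomial \<Rightarrow> 'v monomial" where
  "cover_exponent m =
     (\<Sum>C\<in>Poly_Mapping.keys m. \<Sum>v\<in>C. Poly_Mapping.single v (Poly_Mapping.lookup m C))"

lemma monom_poly_sum: "monom_poly (\<Sum>i\<in>S. f i) = (\<Prod>i\<in>S. monom_poly (f i))"
  by (induction S rule: infinite_finite_induct) (auto simp: monom_poly_mult, auto simp: monom_poly_def)

lemma cover_monomial_power: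
  "(cover_monomial C :: ('v, 'k :: comm_ring_1) mpoly) ^ k =
     monom_poly (\<Sum>v\<in>C. Poly_Mapping.single v k)"
proof (induction k)
  case 0
  then show ?case by (simp add: monom_poly_def)
next
  case (Suc k)
  have "(cover_monomial C :: ('v, 'k) mpoly) ^ Suc k = monom_poly (\<Sum>v\<in>C. Poly_Mapping.single v 1)
      * monom_poly (\<Sum>v\<in>C. Poly_Mapping.single v k)"
    unfolding power_Suc Suc by (simp add: cover_monomial_def monom_poly_sum mpoly_var_def)
  also have "\<dots> = monom_poly (\<Sum>v\<in>C. Poly_Mapping.single v (Suc k))"
    by (simp add: monom_poly_mult[symmetric] sum.distrib[symmetric] single_add[symmetric])
  finally show ?case .
qed

text \<open>Different \<open>m\<close> may have the same \<open>cover_exponent\<close>, so the terms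
  on the right can cancel.\<close>

lemma mpoly_subst_cover_monomial:
  "mpoly_subst cover_monomial p =
     (\<Sum>m\<in>Poly_Mapping.keys p. Poly_Mapping.single (cover_exponent m) (Poly_Mapping.lookup p m))"
  unfolding mpoly_subst_def cover_monomial_power monom_poly_sum[symmetric] cover_exponent_def[symmetric]
  by (simp add: mpoly_const_def monom_poly_def mult_single)

text \<open>Summing over a fixed finite \<open>M\<close> instead of the support of \<open>m\<close>
  makes the images of different monomials comparable.\<close>

lemma lookup_cover_exponent:
  assumes "finite M" "\<And>C. C \<in> M \<Longrightarrow> finite C" "Poly_Mapping.keys m \<subseteq> M"
  shows "Poly_Mapping.lookup (cover_exponent m) s = (\<Sum>C\<in>{C \<in> M. s \<in> C}. Poly_Mapping.lookup m C)"
proof -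
  have "Poly_Mapping.lookup (cover_exponent m) s =
      (\<Sum>C\<in>Poly_Mapping.keys m. \<Sum>v\<in>C. if v = s then Poly_Mapping.lookup m C else 0)"
    by (simp add: cover_exponent_def lookup_sum lookup_single when_def)
  also have "\<dots> = (\<Sum>C\<in>Poly_Mapping.keys m. if s \<in> C then Poly_Mapping.lookup m C else 0)"
    using assms by (intro sum.cong) auto
  also have "\<dots> = (\<Sum>C\<in>M. if s \<in> C then Poly_Mapping.lookup m C else 0)"
    using assms by (intro sum.mono_neutral_left) (auto simp: in_keys_iff)
  also have "\<dots> = (\<Sum>C\<in>{C \<in> M. s \<in> C}. Poly_Mapping.lookup m C)"
    using assms(1) by (simp add: sum.inter_filter)
  finally show ?thesis .
qed

lemma cover_exponent_add:
  assumes "finite M" "\<And>C. C \<in> M \<Longrightarrow> finite C" "Poly_Mapping.keys a \<subseteq> M" "Poly_Mapping.keys b \<subseteq> M"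
  shows "cover_exponent (a + b) = cover_exponent a + cover_exponent b"
proof (rule poly_mapping_eqI)
  fix s
  have "Poly_Mapping.keys (a + b) \<subseteq> M" using assms(3,4) keys_add[of a b] by blast
  then show "Poly_Mapping.lookup (cover_exponent (a + b)) s =
      Poly_Mapping.lookup (cover_exponent a + cover_exponent b) s"
    using assms by (simp add: lookup_cover_exponent[of M] lookup_add sum.distrib)
qed

lemma toric_ideal_iff:
  "p \<in> toric_ideal V E \<longleftrightarrow> p \<in> carrier (mpoly_ring (minimal_vertex_covers V E)) \<and>
     (\<Sum>m\<in>Poly_Mapping.keys p. Poly_Mapping.single (cover_exponent m) (Poly_Mapping.lookup p m)) = 0"
  by (simp add: toric_ideal_def a_kernel_def' cover_poly_ring_def cover_algebra_def
      mpoly_subst_cover_monomial) (simp add: mpoly_ring_def)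

section \<open>Fibres of the toric map and initial monomials\<close>

context cover_lattice
begin

text \<open>The exponent vector of \<open>z\<^sub>C z\<^sub>D\<close>.\<close>

abbreviation quad :: "'v set \<Rightarrow> 'v set \<Rightarrow> 'v set monomial" where
  "quad C D \<equiv> Poly_Mapping.single C 1 + Poly_Mapping.single D 1"

text \<open>Each vertex lies in as many of the meet and the join as of \<open>C\<close> and
  \<open>D\<close>.\<close>

lemma cover_exponent_quad:
  assumes "C \<in> M" "D \<in> M"
  shows "cover_exponent (quad C D) = cover_exponent (quad (cover_meet X Y C D) (cover_meet Y X C D))"
proof (rule poly_mapping_eqI)
  fix s
  have *: "Poly_Mapping.lookup (cover_exponent (quad A B)) s =
      (if s \<in> A then 1 else 0) + (if s \<in> B then 1 else 0)" if "A \<in> M" "B \<in> M" for A B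
  proof -
    have "cover_exponent (quad A B) =
      cover_exponent (Poly_Mapping.single A 1) + cover_exponent (Poly_Mapping.single B 1)"
      using that finite_M finite_mem by (intro cover_exponent_add[of M]) auto
    then show ?thesis using that finite_mem
      by (simp add: cover_exponent_def lookup_add lookup_sum lookup_single when_def)
  qed
  show "Poly_Mapping.lookup (cover_exponent (quad C D)) s =
      Poly_Mapping.lookup (cover_exponent (quad (cover_meet X Y C D) (cover_meet Y X C D))) s"
    unfolding *[OF assms] *[OF meet_M[OF assms] join_M[OF assms]]
    using disjoint M_sub[OF assms(1)] M_sub[OF assms(2)] by (auto simp: cover_meet_def)
qed

text \<open>Double counting: each cover has \<open>c\<close> vertices, so the image of a monomial
  has \<open>c\<close> times its degree, and \<open>c > 0\<close> can be cancelled.\<close>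

lemma mdegree_eq_of_cover_exponent_eq:
  assumes "Poly_Mapping.keys a \<subseteq> M" "Poly_Mapping.keys b \<subseteq> M"
    "cover_exponent a = cover_exponent b"
  shows "mdegree a = mdegree b"
proof -
  have "(\<Sum>s\<in>X \<union> Y. Poly_Mapping.lookup (cover_exponent m) s) = c * mdegree m"
    if m: "Poly_Mapping.keys m \<subseteq> M" for m
  proof -
    have "(\<Sum>s\<in>X \<union> Y. Poly_Mapping.lookup (cover_exponent m) s) =
        (\<Sum>s\<in>X \<union> Y. \<Sum>C\<in>M. if s \<in> C then Poly_Mapping.lookup m C else 0)"
      using m finite_M finite_mem by (simp add: lookup_cover_exponent[of M] sum.inter_filter)
    also have "\<dots> = (\<Sum>C\<in>M. \<Sum>s\<in>X \<union> Y. if s \<in> C then Poly_Mapping.lookup m C else 0)"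
      by (rule sum.swap)
    also have "\<dots> = (\<Sum>C\<in>M. c * Poly_Mapping.lookup m C)"
    proof (rule sum.cong[OF refl])
      fix C assume C: "C \<in> M"
      have "{s \<in> X \<union> Y. s \<in> C} = C" using M_sub[OF C] by auto
      then show "(\<Sum>s\<in>X \<union> Y. if s \<in> C then Poly_Mapping.lookup m C else 0) =
          c * Poly_Mapping.lookup m C"
        using finite_X finite_Y card_M[OF C] by (simp add: sum.inter_filter[symmetric])
    qed
    finally show ?thesis using m finite_M by (simp add: mdegree_eq_sum sum_distrib_left)
  qed
  then show ?thesis using assms c_pos by (metis mult_cancel1 neq0_conv)
qed

text \<open>The image of the initial monomial \<open>m\<close> must be cancelled by another monomial
  of \<open>p\<close> in the same fibre. That one is smaller than \<open>m\<close>, which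
  \<open>chain_minimal_in_fibre\<close> excludes when \<open>m\<close> is supported on a
  chain.\<close>

lemma initial_not_chain:
  fixes p :: "('v set, 'k :: field) mpoly"
  assumes r: "linear_order_on M r"
    "\<And>C D. C \<in> M \<Longrightarrow> D \<in> M \<Longrightarrow> cover_le X Y C D \<Longrightarrow> (C, D) \<in> r"
    and p: "p \<in> carrier (mpoly_ring M)"
    and zero: "(\<Sum>m\<in>Poly_Mapping.keys p.
      Poly_Mapping.single (cover_exponent m) (Poly_Mapping.lookup p m)) = 0"
    and m: "m \<in> Poly_Mapping.keys p"
      "\<And>m'. m' \<in> Poly_Mapping.keys p \<Longrightarrow> m' \<noteq> m \<Longrightarrow> grevlex r m' m"
  shows "\<exists>C\<in>Poly_Mapping.keys m. \<exists>D\<in>Poly_Mapping.keys m.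
    \<not> cover_le X Y C D \<and> \<not> cover_le X Y D C"
proof (rule ccontr)
  assume "\<not> ?thesis"
  then have chain: "cover_le X Y C D \<or> cover_le X Y D C"
    if "C \<in> Poly_Mapping.keys m" "D \<in> Poly_Mapping.keys m" for C D
    using that by blast
  have "\<exists>m'\<in>Poly_Mapping.keys p. m' \<noteq> m \<and> cover_exponent m' = cover_exponent m"
  proof (rule ccontr)
    assume none: "\<not> ?thesis"
    \<comment> \<open>Compare coefficients at \<open>cover_exponent m\<close>; if \<open>m\<close>
      were alone in its fibre, only its own nonzero coefficient would remain.\<close>
    have "0 = (\<Sum>m'\<in>Poly_Mapping.keys p.
        if cover_exponent m' = cover_exponent m then Poly_Mapping.lookup p m' else 0)"
      using arg_cong[OF zero, of "\<lambda>q. Poly_Mapping.lookup q (cover_exponent m)"]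
      by (simp add: lookup_sum lookup_single when_def)
    also have "\<dots> = (\<Sum>m'\<in>Poly_Mapping.keys p. if m' = m then Poly_Mapping.lookup p m' else 0)"
      using none by (intro sum.cong) auto
    also have "\<dots> = Poly_Mapping.lookup p m" using m(1) by simp
    finally show False using m(1) by (simp add: in_keys_iff)
  qed
  then obtain m' where m': "m' \<in> Poly_Mapping.keys p" "m' \<noteq> m"
    "cover_exponent m' = cover_exponent m" by blast
  have keys: "Poly_Mapping.keys m \<subseteq> M" "Poly_Mapping.keys m' \<subseteq> M"
    using p m(1) m'(1) by (auto simp: mpoly_ring_def)
  have deg: "mdegree m' = mdegree m"
    using mdegree_eq_of_cover_exponent_eq keys m'(3) by blast
  then obtain v where v: "Poly_Mapping.lookup m v < Poly_Mapping.lookup m' v"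
    "\<And>w. (w, v) \<in> r \<Longrightarrow> w \<noteq> v \<Longrightarrow> Poly_Mapping.lookup m' w = Poly_Mapping.lookup m w"
    using m(2)[OF m'(1,2)] by (auto simp: grevlex_def)
  show False
  proof (rule chain_minimal_in_fibre[OF r, of "Poly_Mapping.lookup m" "Poly_Mapping.lookup m'" v])
    show "v \<in> M" using v(1) keys(2) by (auto simp: in_keys_iff)
    show "sum (Poly_Mapping.lookup m) M = sum (Poly_Mapping.lookup m') M"
      using deg keys finite_M by (simp add: mdegree_eq_sum)
    show "sum (Poly_Mapping.lookup m) {C \<in> M. s \<in> C} = sum (Poly_Mapping.lookup m') {C \<in> M. s \<in> C}" for s
      using arg_cong[OF m'(3), of "\<lambda>e. Poly_Mapping.lookup e s"] keys finite_M finite_mem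
      by (simp add: lookup_cover_exponent[of M])
  qed (use chain v in \<open>auto simp: in_keys_iff\<close>)
qed

text \<open>The meet comes first among the four covers and occurs only in the left monomial. A
  larger exponent at the first differing variable makes a monomial smaller.\<close>

lemma grevlex_quad:
  assumes r: "linear_order_on M r"
    "\<And>C D. C \<in> M \<Longrightarrow> D \<in> M \<Longrightarrow> cover_le X Y C D \<Longrightarrow> (C, D) \<in> r"
    and C: "C \<in> M" and D: "D \<in> M" and inc: "\<not> cover_le X Y C D" "\<not> cover_le X Y D C"
  shows "grevlex r (quad (cover_meet X Y C D) (cover_meet Y X C D)) (quad C D)"
proof -
  let ?A = "cover_meet X Y C D" and ?B = "cover_meet Y X C D"
  have mem: "?A \<in> M" "?B \<in> M" using C D meet_M join_M by auto
  have le: "cover_le X Y ?A C" "cover_le X Y ?A D" "cover_le X Y ?A ?B"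
    using disjoint by (auto simp: cover_le_def cover_meet_def)
  then have "(?A, C) \<in> r" "(?A, D) \<in> r" "(?A, ?B) \<in> r" using r(2) C D mem by auto
  moreover have "antisym r" using r(1) by (simp add: order_on_defs)
  ultimately have first: "w \<notin> {C, D, ?B}" if "(w, ?A) \<in> r" "w \<noteq> ?A" for w
    using that by (auto dest: antisymD)
  \<comment> \<open>A meet equal to \<open>C\<close> or \<open>D\<close> would make the pair
    comparable.\<close>
  have ne: "?A \<noteq> C" "?A \<noteq> D" using le inc by auto
  show ?thesis
    unfolding grevlex_def
  proof (intro disjI2 conjI exI[of _ ?A] allI impI)
    show "mdegree (quad ?A ?B) = mdegree (quad C D)" by (simp add: mdegree_add)
    show "Poly_Mapping.lookup (quad C D) ?A < Poly_Mapping.lookup (quad ?A ?B) ?A"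
      using ne by (simp add: lookup_add lookup_single when_def)
    fix w assume "(w, ?A) \<in> r \<and> w \<noteq> ?A"
    then have "?A \<noteq> w" "?B \<noteq> w" "C \<noteq> w" "D \<noteq> w" using first[of w] by blast+
    then show "Poly_Mapping.lookup (quad ?A ?B) w = Poly_Mapping.lookup (quad C D) w"
      by (simp add: lookup_add lookup_single_not_eq)
  qed
qed

end

section \<open>The initial ideal and its quadratic generators\<close>

lemma monom_poly_in_carrier:
  "Poly_Mapping.keys m \<subseteq> A \<Longrightarrow> monom_poly m \<in> carrier (mpoly_ring A)"
  by (simp add: mpoly_ring_def monom_poly_def)

lemma monom_poly_add_in_ideal:
  assumes "ideal I (mpoly_ring A)" "monom_poly a \<in> I" "Poly_Mapping.keys b \<subseteq> A"
  shows "monom_poly (a + b) \<in> I"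
  using ideal.I_r_closed[OF assms(1,2) monom_poly_in_carrier[OF assms(3)]]
  by (simp add: monom_poly_mult) (simp add: mpoly_ring_def)

text \<open>The difference of exponents is truncated, so the assumption that \<open>a\<close>
  divides \<open>m\<close> is what restores \<open>m\<close>.\<close>

lemma monomial_diff_add:
  fixes m a :: "'v monomial"
  assumes "\<And>v. Poly_Mapping.lookup a v \<le> Poly_Mapping.lookup m v"
  shows "a + (m - a) = m"
  using assms by (intro poly_mapping_eqI) (simp add: lookup_add lookup_minus)

lemma keys_diff_subset:
  fixes m a :: "'v monomial"
  shows "Poly_Mapping.keys (m - a) \<subseteq> Poly_Mapping.keys m"
  by (auto simp: in_keys_iff lookup_minus)

theorem theorem3p1:
  fixes n :: nat and V :: "vertex set" and E :: "vertex set set"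
    and I\<^sub>G :: "(vertex set, 'k :: field) mpoly set"
  defines "V \<equiv> x_vertices n \<union> y_vertices n"
    and "I\<^sub>G \<equiv> toric_ideal V E"
  assumes "n \<ge> 1"
    and "simple_graph V E"
    and "no_isolated_vertices V E"
    and "bipartition V E (x_vertices n) (y_vertices n)"
    and "unmixed V E"
  shows "\<exists>r. linear_order_on (minimal_vertex_covers V E) r \<and>
           (\<exists>B. (\<forall>m\<in>B. Poly_Mapping.keys m \<subseteq> minimal_vertex_covers V E \<and>
                        squarefree_monomial m \<and> mdegree m = 2) \<and>
                initial_ideal (minimal_vertex_covers V E) (grevlex r) I\<^sub>G =
                  Idl\<^bsub>cover_poly_ring V E\<^esub> (monom_poly ` B))"
proof -
  define X Y M where "X = x_vertices n" and "Y = y_vertices n" and "M = minimal_vertex_covers V E"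
  let ?R = "mpoly_ring M :: (vertex set, 'k) mpoly ring"
  interpret R: cring ?R by (rule cring_mpoly_ring)
  \<comment> \<open>A vertex that is not isolated provides the edge behind
    \<open>c > 0\<close>.\<close>
  have "Vx 1 \<in> V" using \<open>n \<ge> 1\<close> by (auto simp: V_def x_vertices_def)
  then have "E \<noteq> {}" using assms(5) by (auto simp: no_isolated_vertices_def)
  then obtain c where "cover_lattice X Y M c"
    using cover_lattice_minimal_vertex_covers[OF assms(4,6,7)] by (auto simp: X_def Y_def M_def)
  then interpret cover_lattice X Y M c .
  obtain r where r: "linear_order_on M r"
    "\<And>C D. C \<in> M \<Longrightarrow> D \<in> M \<Longrightarrow> cover_le X Y C D \<Longrightarrow> (C, D) \<in> r"
    using linear_extension by blast
  \<comment> \<open>The generators are the products of incomparable pairs; \<open>B\<close> is empty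
    when \<open>M\<close> is a chain.\<close>
  define B where "B = {quad C D | C D. C \<in> M \<and> D \<in> M \<and> \<not> cover_le X Y C D \<and> \<not> cover_le X Y D C}"
  define G :: "(vertex set, 'k) mpoly set"
    where "G = {monom_poly (initial_monomial (grevlex r) p) | p. p \<in> I\<^sub>G \<and> p \<noteq> 0}"
  have B: "Poly_Mapping.keys m \<subseteq> M \<and> squarefree_monomial m \<and> mdegree m = 2" if m: "m \<in> B" for m
  proof -
    obtain C D where CD: "m = quad C D" "C \<in> M" "D \<in> M" "\<not> cover_le X Y C D"
      using m by (auto simp: B_def)
    then have "C \<noteq> D" by (auto simp: cover_le_def)
    then show ?thesis using CD keys_add[of "Poly_Mapping.single C 1" "Poly_Mapping.single D 1 :: _ \<Rightarrow>\<^sub>0 nat"]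
      by (auto simp: squarefree_monomial_def mdegree_add lookup_add lookup_single when_def)
  qed
  have initial: "initial_monomial (grevlex r) p \<in> Poly_Mapping.keys p \<and>
      (\<forall>m'\<in>Poly_Mapping.keys p. m' \<noteq> initial_monomial (grevlex r) p \<longrightarrow>
        grevlex r m' (initial_monomial (grevlex r) p))"
    if "p \<in> carrier ?R" "p \<noteq> 0" for p
    unfolding initial_monomial_def
    by (rule theI') (rule initial_monomial_unique[OF r(1) finite_M that])
  have toric: "p \<in> I\<^sub>G \<longleftrightarrow> p \<in> carrier ?R \<and> (\<Sum>m\<in>Poly_Mapping.keys p.
      Poly_Mapping.single (cover_exponent m) (Poly_Mapping.lookup p m)) = 0" for p
    unfolding I\<^sub>G_def M_def by (rule toric_ideal_iff)
  have BR: "monom_poly ` B \<subseteq> carrier ?R" using B by (auto intro!: monom_poly_in_carrier)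
  have GR: "G \<subseteq> carrier ?R"
  proof
    fix g assume "g \<in> G"
    then obtain p where p: "p \<in> I\<^sub>G" "p \<noteq> 0" "g = monom_poly (initial_monomial (grevlex r) p)"
      by (auto simp: G_def)
    then have "initial_monomial (grevlex r) p \<in> Poly_Mapping.keys p" "p \<in> carrier ?R"
      using initial toric by auto
    then show "g \<in> carrier ?R"
      unfolding p(3) by (intro monom_poly_in_carrier) (auto simp: mpoly_ring_def)
  qed
  \<comment> \<open>Every initial monomial contains an incomparable pair, hence is divisible by an
    element of \<open>B\<close>.\<close>
  have "G \<subseteq> Idl\<^bsub>?R\<^esub> (monom_poly ` B)"
  proof
    fix g assume "g \<in> G"
    then obtain p where p: "p \<in> I\<^sub>G" "p \<noteq> 0" "g = monom_poly (initial_monomial (grevlex r) p)"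
      by (auto simp: G_def)
    define m where "m = initial_monomial (grevlex r) p"
    have pR: "p \<in> carrier ?R" using p toric by simp
    have m: "m \<in> Poly_Mapping.keys p"
        "\<And>m'. m' \<in> Poly_Mapping.keys p \<Longrightarrow> m' \<noteq> m \<Longrightarrow> grevlex r m' m"
      using initial[OF pR p(2)] by (auto simp: m_def)
    then have mM: "Poly_Mapping.keys m \<subseteq> M" using pR by (auto simp: mpoly_ring_def)
    obtain C D where CD: "C \<in> Poly_Mapping.keys m" "D \<in> Poly_Mapping.keys m"
        "\<not> cover_le X Y C D" "\<not> cover_le X Y D C"
      using initial_not_chain[OF r pR _ m] p(1) toric by blast
    have "quad C D \<in> B" using CD mM by (auto simp: B_def)
    then have "monom_poly (quad C D) \<in> Idl\<^bsub>?R\<^esub> (monom_poly ` B)"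
      using R.genideal_self[OF BR] by blast
    then have "monom_poly (quad C D + (m - quad C D)) \<in> Idl\<^bsub>?R\<^esub> (monom_poly ` B)"
      by (rule monom_poly_add_in_ideal[OF R.genideal_ideal[OF BR]])
        (use mM keys_diff_subset[of m "quad C D"] in blast)
    moreover have "quad C D + (m - quad C D) = m"
    proof (rule monomial_diff_add)
      \<comment> \<open>Distinctness makes the product squarefree, so occurrence of both variables
        in \<open>m\<close> suffices for divisibility.\<close>
      have "C \<noteq> D" using CD(3) by (auto simp: cover_le_def)
      then show "Poly_Mapping.lookup (quad C D) v \<le> Poly_Mapping.lookup m v" for v
        using CD(1,2) by (auto simp: lookup_add lookup_single when_def in_keys_iff)
    qed
    ultimately show "g \<in> Idl\<^bsub>?R\<^esub> (monom_poly ` B)" by (simp add: p(3) m_def)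
  qed
  moreover have "monom_poly ` B \<subseteq> G"
  proof (rule image_subsetI)
    fix b assume "b \<in> B"
    then obtain C D where CD: "b = quad C D" "C \<in> M" "D \<in> M"
        "\<not> cover_le X Y C D" "\<not> cover_le X Y D C"
      by (auto simp: B_def)
    define a where "a = quad (cover_meet X Y C D) (cover_meet Y X C D)"
    \<comment> \<open>The binomial of the pair: its two terms have the same image, and
      \<open>b\<close> is the larger one.\<close>
    define p :: "(vertex set, 'k) mpoly" where "p = monom_poly b - monom_poly a"
    have less: "grevlex r a b" unfolding CD(1) a_def by (rule grevlex_quad[OF r CD(2-)])
    then have "a \<noteq> b" by (auto simp: grevlex_def)
    then have lookup: "Poly_Mapping.lookup p b = 1" "Poly_Mapping.lookup p a = -1"
      and keys: "Poly_Mapping.keys p = {a, b}"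
      by (auto simp: p_def monom_poly_def lookup_minus lookup_single when_def in_keys_iff
          split: if_splits)
    have "Poly_Mapping.keys (quad S T) \<subseteq> M" if "S \<in> M" "T \<in> M" for S T
      using that keys_add[of "Poly_Mapping.single S 1" "Poly_Mapping.single T 1 :: _ \<Rightarrow>\<^sub>0 nat"] by auto
    then have "Poly_Mapping.keys a \<subseteq> M" "Poly_Mapping.keys b \<subseteq> M"
      using CD meet_M join_M by (auto simp: a_def)
    then have pR: "p \<in> carrier ?R" by (simp add: mpoly_ring_def keys)
    moreover have "cover_exponent a = cover_exponent b"
      unfolding a_def CD(1) using cover_exponent_quad[OF CD(2,3)] by simp
    ultimately have "p \<in> I\<^sub>G"
      using \<open>a \<noteq> b\<close> by (simp add: toric keys lookup single_add[symmetric])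
    moreover have "p \<noteq> 0" using keys by auto
    moreover have "initial_monomial (grevlex r) p = b"
      unfolding initial_monomial_def
      by (rule the1_equality[OF initial_monomial_unique[OF r(1) finite_M pR \<open>p \<noteq> 0\<close>]])
        (use less keys in auto)
    ultimately show "monom_poly b \<in> G" by (auto simp: G_def)
  qed
  then have "monom_poly ` B \<subseteq> Idl\<^bsub>?R\<^esub> G" using R.genideal_self[OF GR] by blast
  ultimately have "Idl\<^bsub>?R\<^esub> G = Idl\<^bsub>?R\<^esub> (monom_poly ` B)"
    by (intro equalityI R.genideal_minimal R.genideal_ideal GR BR)
  then have "initial_ideal M (grevlex r) I\<^sub>G = Idl\<^bsub>cover_poly_ring V E\<^esub> (monom_poly ` B)"
    by (simp add: initial_ideal_def G_def cover_poly_ring_def M_def)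
  then show ?thesis using r(1) B unfolding M_def by blast
qed

end
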